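(* The group $\mathrm{SL}(3,\mathbb{C})^3$ acts on $\mathcal{J}=\mathrm{M}_3(\mathbb{C})^3$, preserving the cubic norm $N$, as follows: $$R(g,h,k)(A_0,A_1,A_2)=(gA_0h^{-1},\ hA_1k^{-1},\ kA_2g^{-1}).$$ This gives a homomorphism $R\colon\mathrm{SL}(3,\mathbb{C})^3\to\mathrm{E}_6$ whose kernel is $$\{(\omega I,\omega I,\omega I)\mid\omega^3=1\}\cong\mathbb{Z}_3.$$
   Context: $\mathcal{J}=\mathrm{M}_3(\mathbb{C})\oplus\mathrm{M}_3(\mathbb{C})\oplus\mathrm{M}_3(\mathbb{C})$ is the 27-dimensional complex vector space of triples $(A_0,A_1,A_2)$ of complex $3\times3$ matrices. Its cubic norm is $N(A_0,A_1,A_2)=\det(A_0)+\det(A_1)+\det(A_2)-\mathrm{tr}(A_0A_1A_2)$. Here $\mathrm{E}_6$ denotes the complex form of the exceptional Lie group, realized as the group of all invertible complex-linear transformations of $\mathcal{J}$ that preserve $N$. $I$ is the $3\times3$ identity matrix and $\omega\in\mathbb{C}$. *)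

theory Defs
  imports
    "HOL-Analysis.Analysis"
    "HOL-Algebra.Group_Action"
    "HOL-Algebra.Elementary_Groups"
begin

type_synonym mat3 = "complex^3^3"

type_synonym jordan = "mat3 \<times> mat3 \<times> mat3"

text \<open>
  The \<^term>\<open>scaleR\<close> supplied by the product and vector types is only the real
  structure, so the complex one is spelled out.
\<close>

definition jscale :: "complex \<Rightarrow> jordan \<Rightarrow> jordan" where
  "jscale c = (\<lambda>(A\<^sub>0, A\<^sub>1, A\<^sub>2).
     (map_matrix ((*) c) A\<^sub>0, map_matrix ((*) c) A\<^sub>1, map_matrix ((*) c) A\<^sub>2))"

lemma vector_space_jscale: "vector_space jscale"
  by unfold_locales
    (auto simp: jscale_def map_matrix_def vec_eq_iff algebra_simps)

definition cubic_norm :: "jordan \<Rightarrow> complex" where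
  "cubic_norm = (\<lambda>(A\<^sub>0, A\<^sub>1, A\<^sub>2).
     det A\<^sub>0 + det A\<^sub>1 + det A\<^sub>2 - trace (A\<^sub>0 ** A\<^sub>1 ** A\<^sub>2))"

definition E6 :: "(jordan \<Rightarrow> jordan) monoid" where
  "E6 = \<lparr>carrier = {f. Vector_Spaces.linear jscale jscale f \<and> bij f \<and>
                        (\<forall>x. cubic_norm (f x) = cubic_norm x)},
         monoid.mult = (\<circ>), one = id\<rparr>"

definition SL3 :: "mat3 monoid" where
  "SL3 = \<lparr>carrier = {A. det A = 1}, monoid.mult = (**), one = mat 1\<rparr>"

definition SL3_cubed :: "(mat3 \<times> mat3 \<times> mat3) monoid" where
  "SL3_cubed = SL3 \<times>\<times> SL3 \<times>\<times> SL3"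

definition R :: "mat3 \<times> mat3 \<times> mat3 \<Rightarrow> jordan \<Rightarrow> jordan" where
  "R = (\<lambda>(g, h, k) (A\<^sub>0, A\<^sub>1, A\<^sub>2).
     (g ** A\<^sub>0 ** matrix_inv h, h ** A\<^sub>1 ** matrix_inv k, k ** A\<^sub>2 ** matrix_inv g))"

end

theory Submission
  imports Defs
begin

text \<open>
  Apart from the description of the kernel, everything comes from cancelling inverses.
  The map \<^term>\<open>R\<close> is multiplicative because inversion reverses products, so each
  \<^term>\<open>R s\<close> is bijective with inverse \<^term>\<open>R\<close> of the inverse triple. It preserves the cubic norm
  because determinants are multiplicative and because in the product
  \<open>(g A\<^sub>0 h\<^sup>-\<^sup>1) (h A\<^sub>1 k\<^sup>-\<^sup>1) (k A\<^sub>2 g\<^sup>-\<^sup>1)\<close> the inner factors cancel,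
  leaving a conjugate of \<open>A\<^sub>0 A\<^sub>1 A\<^sub>2\<close>.

  For the kernel, evaluating the trivial action of \<open>(g, h, k)\<close> at \<open>(I, I, I)\<close>
  gives \<open>g = h = k\<close>. Then \<open>g\<close> commutes with every matrix, hence is a scalar
  \<open>\<omega> I\<close> (lemma \<open>commuting_imp_scalar\<close>), and \<open>det g = 1\<close> says \<open>\<omega>\<^sup>3 = 1\<close>.
  The kernel is thus a copy of the group of cube roots of unity, which is cyclic of order
  three through \<open>j \<mapsto> exp (2 \<pi> i j / 3)\<close> (lemma \<open>iso_roots_of_unity\<close>).
\<close>

section \<open>Inverse and scalar matrices\<close>

lemma
  fixes A :: "'a::semiring_1^'n^'m"
  assumes "invertible A"
  shows matrix_mul_inv_right: "A ** matrix_inv A = mat 1"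
    and matrix_mul_inv_left: "matrix_inv A ** A = mat 1"
proof -
  have "A ** matrix_inv A = mat 1 \<and> matrix_inv A ** A = mat 1"
    unfolding matrix_inv_def by (rule someI_ex) (use assms in \<open>simp add: invertible_def\<close>)
  then show "A ** matrix_inv A = mat 1" "matrix_inv A ** A = mat 1" by auto
qed

lemma matrix_inv_unique:
  fixes A :: "'a::field^'n^'n"
  assumes "A ** B = mat 1"
  shows "matrix_inv A = B"
proof -
  have "invertible A"
    using assms invertible_right_inverse by blast
  then have "matrix_inv A = matrix_inv A ** (A ** B)"
    using assms by simp
  also have "\<dots> = B"
    using \<open>invertible A\<close> by (simp add: matrix_mul_assoc matrix_mul_inv_left)
  finally show ?thesis .
qed

lemma matrix_inv_mult:
  fixes A B :: "'a::field^'n^'n"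
  assumes "invertible A" "invertible B"
  shows "matrix_inv (A ** B) = matrix_inv B ** matrix_inv A"
proof (rule matrix_inv_unique)
  have "A ** B ** (matrix_inv B ** matrix_inv A) = A ** (B ** matrix_inv B) ** matrix_inv A"
    by (simp add: matrix_mul_assoc)
  then show "A ** B ** (matrix_inv B ** matrix_inv A) = mat 1"
    using assms by (simp add: matrix_mul_inv_right)
qed

lemma matrix_inv_one: "matrix_inv (mat 1 :: 'a::field^'n^'n) = mat 1"
  by (rule matrix_inv_unique) simp

lemma mat_mult_left: "mat c ** A = map_matrix ((*) c) (A :: 'a::semiring_1^'n^'m)"
  by (simp add: vec_eq_iff matrix_matrix_mult_def mat_def map_matrix_def if_distrib if_distribR
      sum.delta cong: if_cong)

lemma mat_mult_commute: "mat c ** A = A ** mat (c :: 'a::comm_semiring_1)"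
  by (simp add: vec_eq_iff matrix_matrix_mult_def mat_def if_distrib if_distribR
      sum.delta sum.delta' mult.commute cong: if_cong)

lemma mat_mult_mat: "mat a ** mat b = (mat (a * b) :: 'a::semiring_1^'n^'n)"
  by (simp add: mat_mult_left) (simp add: vec_eq_iff map_matrix_def mat_def)

lemma mat_inject [simp]: "(mat a :: 'a::zero^'n^'n) = mat b \<longleftrightarrow> a = b"
  by (auto simp: vec_eq_iff mat_def)

lemma det_mat: "det (mat c :: 'a::comm_ring_1^'n^'n) = c ^ CARD('n)"
  by (subst det_diagonal) (simp_all add: mat_def)

text \<open>
  Commuting with the matrix unit \<open>E\<^sub>j\<^sub>k\<close> and comparing entries \<open>(i, k)\<close> already
  forces \<open>A\<^sub>i\<^sub>j = \<delta>\<^sub>i\<^sub>j A\<^sub>k\<^sub>k\<close>.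
\<close>
lemma commuting_imp_scalar:
  fixes A :: "'a::comm_semiring_1^'n^'n"
  assumes comm: "\<And>B. A ** B = B ** A"
  obtains c where "A = mat c"
proof -
  \<comment> \<open>All diagonal entries turn out equal, so any fixed index can supply the scalar.\<close>
  define k :: 'n where "k = undefined"
  define c where "c = A $ k $ k"
  have "A $ i $ j = mat c $ i $ j" for i j
  proof -
    define E :: "'a^'n^'n" where "E = (\<chi> a b. if a = j then if b = k then 1 else 0 else 0)"
    have "(A ** E) $ i $ k = A $ i $ j"
      by (simp add: E_def matrix_matrix_mult_def if_distrib sum.delta cong: if_cong)
    moreover have "(E ** A) $ i $ k = (if i = j then A $ k $ k else 0)"
      by (simp add: E_def matrix_matrix_mult_def mult_delta_left)
    ultimately show ?thesis
      using comm[of E] by (simp add: mat_def c_def)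
  qed
  then have "A = mat c"
    by (simp add: vec_eq_iff)
  then show ?thesis ..
qed

lemma matrix_add_rdistrib: "(A + B) ** C = A ** C + B ** (C :: 'a::semiring_1^'n^'m)"
  by (simp add: vec_eq_iff matrix_matrix_mult_def distrib_right sum.distrib)

lemma map_matrix_mult_left:
  fixes A :: "'a::semiring_1^'n^'m"
  shows "map_matrix ((*) c) A ** B = map_matrix ((*) c) (A ** B)"
  by (simp flip: mat_mult_left add: matrix_mul_assoc)

lemma map_matrix_mult_right:
  fixes A :: "'a::comm_semiring_1^'n^'m"
  shows "A ** map_matrix ((*) c) B = map_matrix ((*) c) (A ** B)"
proof -
  have "A ** (mat c ** B) = mat c ** (A ** B)"
    by (metis matrix_mul_assoc mat_mult_commute)
  then show ?thesis
    by (simp only: mat_mult_left)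
qed

section \<open>The groups involved\<close>

lemma det_1_imp_invertible: "det (A :: 'a::field^'n^'n) = 1 \<Longrightarrow> invertible A"
  by (simp add: invertible_det_nz)

lemma det_matrix_inv:
  fixes A :: "'a::field^'n^'n"
  assumes "det A = 1"
  shows "det (matrix_inv A) = 1"
  using det_mul[of A "matrix_inv A"] assms
  by (simp add: matrix_mul_inv_right det_1_imp_invertible)

lemma group_SL3: "group SL3"
proof (rule groupI)
  fix A assume "A \<in> carrier SL3"
  then have "det A = 1" by (simp add: SL3_def)
  then show "\<exists>B\<in>carrier SL3. B \<otimes>\<^bsub>SL3\<^esub> A = \<one>\<^bsub>SL3\<^esub>"
    by (intro bexI[of _ "matrix_inv A"])
      (simp_all add: SL3_def det_matrix_inv matrix_mul_inv_left det_1_imp_invertible)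
qed (simp_all add: SL3_def det_mul matrix_mul_assoc)

lemma group_SL3_cubed: "group SL3_cubed"
  unfolding SL3_cubed_def by (intro DirProd_group group_SL3)

lemma SL3_cubed_simps:
  "(g, h, k) \<in> carrier SL3_cubed \<longleftrightarrow> det g = 1 \<and> det h = 1 \<and> det k = 1"
  "(g, h, k) \<otimes>\<^bsub>SL3_cubed\<^esub> (g', h', k') = (g ** g', h ** h', k ** k')"
  "\<one>\<^bsub>SL3_cubed\<^esub> = (mat 1, mat 1, mat 1)"
  by (auto simp: SL3_cubed_def SL3_def)

lemma group_E6: "group E6"
proof (rule groupI)
  fix f assume "f \<in> carrier E6"
  then have f: "Vector_Spaces.linear jscale jscale f" "bij f"
      "\<And>x. cubic_norm (f x) = cubic_norm x"
    by (auto simp: E6_def)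
  have f_inv: "f (inv_into UNIV f x) = x" "inv_into UNIV f (f x) = x" for x
    using f(2) by (simp_all add: bij_is_surj surj_f_inv_f bij_is_inj)
  have "inv_into UNIV f (x + y) = inv_into UNIV f x + inv_into UNIV f y" "inv_into UNIV f (jscale c x) = jscale c (inv_into UNIV f x)" for x y c
    using f(1) f_inv unfolding Vector_Spaces.linear_iff by metis+
  then have "Vector_Spaces.linear jscale jscale (inv_into UNIV f)"
    by (simp add: Vector_Spaces.linear_iff vector_space_jscale)
  moreover have "cubic_norm (inv_into UNIV f x) = cubic_norm x" for x
    using f(3)[of "inv_into UNIV f x"] f_inv by simp
  ultimately show "\<exists>g\<in>carrier E6. g \<otimes>\<^bsub>E6\<^esub> f = \<one>\<^bsub>E6\<^esub>"
    by (intro bexI[of _ "inv_into UNIV f"]) (use f(2) in \<open>auto simp: E6_def bij_imp_bij_inv fun_eq_iff f_inv\<close>)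
qed (auto simp: E6_def Vector_Spaces.linear_iff vector_space_jscale bij_comp comp_assoc
    simp del: split_paired_All)

text \<open>
  The map is defined on all of \<open>\<int>\<close>, where \<open>cis\<close> turns sums into products; having
  period \<open>n\<close>, it still does so when sums are reduced modulo \<open>n\<close>.
\<close>
lemma iso_roots_of_unity:
  assumes "n > 0"
  shows "(\<lambda>j. cis (2 * pi * real_of_int j / real n))
    \<in> iso (integer_mod_group n) \<lparr>carrier = {z. z ^ n = 1}, monoid.mult = (*), one = 1\<rparr>"
    (is "?e \<in> iso _ ?U")
proof (rule isoI)
  have bij_nat: "bij_betw nat {0..<int n} {..<n}"
    by (rule bij_betw_byWitness[where f' = int]) auto
  have "bij_betw ((\<lambda>k. cis (2 * pi * real k / real n)) \<circ> nat) {0..<int n} {z. z ^ n = 1}"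
    by (rule bij_betw_trans[OF bij_nat Complex.bij_betw_roots_unity[OF assms]])
  then have bij: "bij_betw ?e {0..<int n} {z. z ^ n = 1}"
    by (rule bij_betw_cong[THEN iffD1, rotated]) simp
  then show "bij_betw ?e (carrier (integer_mod_group n)) (carrier ?U)"
    using assms by (simp add: carrier_integer_mod_group)
  have periodic: "?e (j mod int n) = ?e j" for j
  proof -
    have "real_of_int j = real_of_int (j mod int n) + real n * real_of_int (j div int n)"
      by (metis mod_mult_div_eq of_int_add of_int_mult of_int_of_nat_eq)
    then have "2 * pi * real_of_int j / real n
        = 2 * pi * real_of_int (j mod int n) / real n + 2 * pi * real_of_int (j div int n)"
      using assms by (simp add: field_simps)
    then have "?e j = ?e (j mod int n) * cis (2 * pi * real_of_int (j div int n))"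
      by (simp only: cis_mult)
    then show ?thesis
      by (simp only: cis_multiple_2pi Ints_of_int mult_1_right)
  qed
  show "?e \<in> hom (integer_mod_group n) ?U"
  proof (rule homI)
    fix i j
    show "?e (i \<otimes>\<^bsub>integer_mod_group n\<^esub> j) = ?e i \<otimes>\<^bsub>?U\<^esub> ?e j"
      by (simp only: mult_integer_mod_group periodic) (simp add: cis_mult distrib_left add_divide_distrib)
  qed (use bij bij_betwE assms in \<open>fastforce simp: carrier_integer_mod_group\<close>)
qed

section \<open>The action on triples of matrices\<close>

lemma R_one: "R \<one>\<^bsub>SL3_cubed\<^esub> = id"
  by (simp add: R_def SL3_cubed_simps matrix_inv_one fun_eq_iff)

lemma R_mult:
  assumes "s \<in> carrier SL3_cubed" "t \<in> carrier SL3_cubed"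
  shows "R (s \<otimes>\<^bsub>SL3_cubed\<^esub> t) = R s \<circ> R t"
proof -
  obtain g h k g' h' k' where st: "s = (g, h, k)" "t = (g', h', k')"
    by (metis prod_cases3)
  show ?thesis
    using assms unfolding st
    by (auto simp: SL3_cubed_simps R_def fun_eq_iff matrix_inv_mult det_1_imp_invertible
        matrix_mul_assoc)
qed

lemma cubic_norm_R:
  assumes "s \<in> carrier SL3_cubed"
  shows "cubic_norm (R s x) = cubic_norm x"
proof -
  obtain g h k where s: "s = (g, h, k)" by (metis prod_cases3)
  obtain A B C where x: "x = (A, B, C)" by (metis prod_cases3)
  have det: "det g = 1" "det h = 1" "det k = 1"
    using assms by (simp_all add: s SL3_cubed_simps)
  have cancel: "Y ** matrix_inv X ** X = Y" if "det X = 1" for X Y :: mat3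
    using that by (simp add: matrix_mul_inv_left det_1_imp_invertible flip: matrix_mul_assoc)
  have "trace (g ** A ** matrix_inv h ** (h ** B ** matrix_inv k) ** (k ** C ** matrix_inv g))
      = trace (g ** (A ** B ** C ** matrix_inv g))"
    by (simp add: matrix_mul_assoc cancel det)
  also have "\<dots> = trace (A ** B ** C)"
    by (subst trace_mul_sym) (simp add: cancel det)
  finally show ?thesis
    by (simp add: s x R_def cubic_norm_def det_mul det det_matrix_inv)
qed

lemma linear_R: "Vector_Spaces.linear jscale jscale (R s)"
  by (cases s) (auto simp: Vector_Spaces.linear_iff vector_space_jscale R_def jscale_def
      matrix_add_ldistrib matrix_add_rdistrib map_matrix_mult_left map_matrix_mult_right)

lemma bij_R:
  assumes "s \<in> carrier SL3_cubed"
  shows "bij (R s)"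
proof -
  interpret group SL3_cubed by (rule group_SL3_cubed)
  show ?thesis
    using assms by (intro o_bij[of "R (inv\<^bsub>SL3_cubed\<^esub> s)"]) (simp_all flip: R_mult add: R_one)
qed

lemma group_hom_R: "group_hom SL3_cubed E6 R"
proof (intro group_hom.intro group_hom_axioms.intro group_SL3_cubed group_E6 homI)
  fix s t assume s: "s \<in> carrier SL3_cubed" and t: "t \<in> carrier SL3_cubed"
  show "R s \<in> carrier E6"
    using s by (simp add: E6_def linear_R bij_R cubic_norm_R)
  show "R (s \<otimes>\<^bsub>SL3_cubed\<^esub> t) = R s \<otimes>\<^bsub>E6\<^esub> R t"
    using s t by (simp add: E6_def R_mult)
qed

lemma group_action_R: "group_action SL3_cubed UNIV R"
proof (intro group_action.intro group_hom.intro group_hom_axioms.intro group_SL3_cubed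
    group_BijGroup homI)
  fix s t assume s: "s \<in> carrier SL3_cubed" and t: "t \<in> carrier SL3_cubed"
  show "R s \<in> carrier (BijGroup UNIV)"
    using s by (simp add: BijGroup_def Bij_def bij_R)
  show "R (s \<otimes>\<^bsub>SL3_cubed\<^esub> t) = R s \<otimes>\<^bsub>BijGroup UNIV\<^esub> R t"
    using s t by (simp add: BijGroup_def Bij_def bij_R R_mult compose_def fun_eq_iff)
qed

section \<open>The kernel\<close>

lemma kernel_R: "kernel SL3_cubed E6 R = {(mat \<omega>, mat \<omega>, mat \<omega>) | \<omega>. \<omega> ^ 3 = 1}"
proof (intro equalityI subsetI)
  fix s assume "s \<in> kernel SL3_cubed E6 R"
  moreover obtain g h k where s: "s = (g, h, k)" by (metis prod_cases3)
  ultimately have det: "det g = 1" "det h = 1" "det k = 1" and triv: "\<And>x. R (g, h, k) x = x"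
    by (auto simp: kernel_def E6_def SL3_cubed_simps)
  have inv_left: "matrix_inv X ** X = mat 1" if "det X = 1" for X :: mat3
    using that by (simp add: matrix_mul_inv_left det_1_imp_invertible)
  have gh: "g ** A = A ** h" and hk: "h ** A = A ** k" for A
  proof -
    have "g ** A ** matrix_inv h = A" "h ** A ** matrix_inv k = A"
      using triv[of "(A, A, A)"] by (simp_all add: R_def)
    then have "g ** A ** (matrix_inv h ** h) = A ** h" "h ** A ** (matrix_inv k ** k) = A ** k"
      by (simp_all add: matrix_mul_assoc)
    then show "g ** A = A ** h" "h ** A = A ** k"
      by (simp_all add: inv_left det)
  qed
  have "g = h" "h = k"
    using gh[of "mat 1"] hk[of "mat 1"] by simp_all
  moreover obtain c where "g = mat c"
    using commuting_imp_scalar gh \<open>g = h\<close> by metis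
  ultimately show "s \<in> {(mat \<omega>, mat \<omega>, mat \<omega>) | \<omega>. \<omega> ^ 3 = 1}"
    using det by (auto simp: s det_mat)
next
  fix s :: "mat3 \<times> mat3 \<times> mat3"
  assume "s \<in> {(mat \<omega>, mat \<omega>, mat \<omega>) | \<omega>. \<omega> ^ 3 = 1}"
  then obtain c where s: "s = (mat c, mat c, mat c)" and c: "c ^ 3 = 1" by blast
  have "det (mat c :: mat3) = 1"
    using c by (simp add: det_mat)
  moreover from this have "A ** mat c ** matrix_inv (mat c) = A" for A :: mat3
    by (simp add: matrix_mul_inv_right det_1_imp_invertible flip: matrix_mul_assoc)
  ultimately show "s \<in> kernel SL3_cubed E6 R"
    by (simp add: s kernel_def SL3_cubed_simps E6_def R_def mat_mult_commute[of c] fun_eq_iff)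
qed

lemma kernel_R_iso: "SL3_cubed\<lparr>carrier := kernel SL3_cubed E6 R\<rparr> \<cong> integer_mod_group 3"
proof -
  let ?U = "\<lparr>carrier = {z. z ^ 3 = 1}, monoid.mult = (*), one = (1::complex)\<rparr>"
  let ?K = "SL3_cubed\<lparr>carrier := kernel SL3_cubed E6 R\<rparr>"
  have "(\<lambda>c. (mat c, mat c, mat c)) \<in> iso ?U ?K"
  proof (rule isoI)
    show "(\<lambda>c. (mat c, mat c, mat c)) \<in> hom ?U ?K"
      by (rule homI) (auto simp: kernel_R SL3_cubed_simps(2) mat_mult_mat)
    show "bij_betw (\<lambda>c. (mat c, mat c, mat c)) (carrier ?U) (carrier ?K)"
    proof (rule bij_betw_imageI)
      show "inj_on (\<lambda>c. (mat c, mat c, mat c :: mat3)) (carrier ?U)"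
        by (rule inj_onI) simp
      show "(\<lambda>c. (mat c, mat c, mat c)) ` carrier ?U = carrier ?K"
        by (auto simp: kernel_R)
    qed
  qed
  then have "?U \<cong> ?K"
    by (rule is_isoI)
  moreover have "integer_mod_group 3 \<cong> ?U"
    using is_isoI[OF iso_roots_of_unity[of 3]] by simp
  ultimately have "integer_mod_group 3 \<cong> ?K"
    by (rule iso_trans[rotated])
  then show ?thesis
    by (rule group.iso_sym[OF group_integer_mod_group])
qed

theorem proposition12:
  shows "group_action SL3_cubed UNIV R
    \<and> (\<forall>s \<in> carrier SL3_cubed. \<forall>x. cubic_norm (R s x) = cubic_norm x)
    \<and> group_hom SL3_cubed E6 R
    \<and> kernel SL3_cubed E6 R = {(mat \<omega>, mat \<omega>, mat \<omega>) | \<omega>. \<omega> ^ 3 = 1}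
    \<and> SL3_cubed\<lparr>carrier := kernel SL3_cubed E6 R\<rparr> \<cong> integer_mod_group 3"
  using group_action_R cubic_norm_R group_hom_R kernel_R kernel_R_iso by blast

end
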